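(* Consider the popularity model described in the context, i.e. for all $i\in\mathcal I$ and integers $t\ge0$, $$x^{(i)}(t+1)=AP\,x^{(i)}(t)+B\mathbf 1_n\,\pi^{(i)}(t)+q^{(i)}(I-A-B)\mathbf 1_n .$$ Assume that, in the graph associated to $P$, for every $v\in\mathcal V$ there exists a path from $v$ to an aperiodic node $w$ such that $\gamma_w>0$. Let $q_{\mathrm{tot}}=\sum_{i\in\mathcal I}q^{(i)}$, $z(t)=\sum_{i\in\mathcal I}x^{(i)}(t)$ and $s^{(i)}(t)=(x^{(i)}(t)^\top,\pi^{(i)}(t))^\top\in\mathbb R^{n+1}$. If $q_{\mathrm{tot}}\ge1$ and $z(0)\ge\mathbf 1_n$ entrywise, then for every $i\in\mathcal I$ the sequence $s^{(i)}(t)$ converges as $t\to\infty$ and $$\lim_{t\to\infty}s^{(i)}(t)=q^{(i)}\,(I-\widetilde U)^{-1}\,\widetilde c,$$ where $$\widetilde U=\begin{bmatrix}AP&B\mathbf 1_n\\ \frac{\mathbf 1_n^\top AP}{\mathbf 1_n^\top z^\star}&\frac{\mathbf 1_n^\top B\mathbf 1_n}{\mathbf 1_n^\top z^\star}\end{bmatrix},\qquad \widetilde c=\begin{bmatrix}(I-A-B)\mathbf 1_n\\ \frac{\mathbf 1_n^\top(I-A-B)\mathbf 1_n}{\mathbf 1_n^\top z^\star}\end{bmatrix},$$ and $z^\star=\lim_{t\to\infty}z(t)=(I-AP)^{-1}\big(B+q_{\mathrm{tot}}(I-A-B)\big)\mathbf 1_n$.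
   Context: $\mathcal V$ is a finite set of $n\ge 1$ users and $\mathcal I$ is a finite nonempty set of influencers. For each user $v$ and influencer $i$, $x_v^{(i)}(t)\in[0,1]$ is the attention of $v$ to $i$ at time $t\in\{0,1,2,\dots\}$, and $x^{(i)}(t)=(x_v^{(i)}(t))_{v\in\mathcal V}\in\mathbb R^n$; $q^{(i)}\in[0,1]$ is the quality of influencer $i$; $\alpha_v,\beta_v,\gamma_v\ge 0$ satisfy $\alpha_v+\beta_v+\gamma_v=1$; $A=\mathrm{diag}(\alpha)$, $B=\mathrm{diag}(\beta)$, so $I-A-B=\mathrm{diag}(\gamma)$. $\mathbf 1_n$ is the all-ones vector in $\mathbb R^n$. $P$ is an $n\times n$ row-stochastic matrix (nonnegative entries, rows summing to 1). The popularity of $i$ at time $t$ is $$\pi^{(i)}(t)=\frac{\sum_{v}x_v^{(i)}(t)}{\sum_{j\in\mathcal I}\sum_{w\in\mathcal V}x_w^{(j)}(t)}.$$ The graph associated to $P$ is the directed graph on $\mathcal V$ with an edge $(v,w)$ whenever $P_{vw}>0$; paths of length zero are allowed (so $w=v$ is possible). A node $v$ is aperiodic if the greatest common divisor of the lengths of all cycles (closed walks of positive length) starting and ending at $v$ equals 1. *)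

theory Defs
  imports "HOL-Analysis.Analysis"
begin

text \<open>Vectors in \<open>\<real>\<^sup>n\<close> are of type \<open>real ^ 'v\<close>, with the users as indices. The all-ones vector is
  \<open>1 :: real ^ 'v\<close> and \<open>\<le>\<close> is the entrywise order, whereas the identity matrix is \<open>mat 1\<close>
  (the numeral \<open>1\<close> at a matrix type would be the all-ones matrix).\<close>

definition diag_mat :: "real ^ 'v \<Rightarrow> real ^ 'v ^ 'v" where
  "diag_mat a = (\<chi> v w. if v = w then a $ v else 0)"

definition row_stochastic :: "real ^ 'v ^ 'v \<Rightarrow> bool" where
  "row_stochastic P \<longleftrightarrow> (\<forall>v w. 0 \<le> P $ v $ w) \<and> (\<forall>v. (\<Sum>w\<in>UNIV. P $ v $ w) = 1)"

definition graph_of :: "real ^ 'v ^ 'v \<Rightarrow> ('v \<times> 'v) set" where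
  "graph_of P = {(v, w). P $ v $ w > 0}"

text \<open>A closed walk of length \<open>k\<close> at \<open>v\<close> exists iff \<open>(v, v) \<in> E ^^ k\<close>. A node on no cycle is not
  aperiodic, since \<open>Gcd {} = 0\<close>.\<close>

definition aperiodic_node :: "('v \<times> 'v) set \<Rightarrow> 'v \<Rightarrow> bool" where
  "aperiodic_node E v \<longleftrightarrow> Gcd {k::nat. k > 0 \<and> (v, v) \<in> E ^^ k} = 1"

definition popularity :: "('i::finite \<Rightarrow> nat \<Rightarrow> real ^ 'v) \<Rightarrow> 'i \<Rightarrow> nat \<Rightarrow> real" where
  "popularity x i t = (\<Sum>v\<in>UNIV. x i t $ v) / (\<Sum>j\<in>UNIV. \<Sum>w\<in>UNIV. x j t $ w)"

definition total_attention :: "('i::finite \<Rightarrow> nat \<Rightarrow> real ^ 'v) \<Rightarrow> nat \<Rightarrow> real ^ 'v" where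
  "total_attention x t = (\<Sum>i\<in>UNIV. x i t)"

text \<open>\<open>\<real>\<^sup>n\<^sup>+\<^sup>1\<close> is \<open>real ^ 'v option\<close>: the index \<open>Some v\<close> is the coordinate of user \<open>v\<close>, and
  \<open>None\<close> is the additional last coordinate.\<close>

definition border_vec :: "real ^ 'v \<Rightarrow> real \<Rightarrow> real ^ 'v option" where
  "border_vec a d = (\<chi> k. case k of Some v \<Rightarrow> a $ v | None \<Rightarrow> d)"

text \<open>\<open>border_mat M b r d\<close> is the block matrix with rows \<open>[M, b]\<close> and \<open>[r\<^sup>T, d]\<close>.\<close>

definition border_mat ::
    "real ^ 'v ^ 'v \<Rightarrow> real ^ 'v \<Rightarrow> real ^ 'v \<Rightarrow> real \<Rightarrow> real ^ 'v option ^ 'v option" where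
  "border_mat M b r d =
    (\<chi> k. case k of Some v \<Rightarrow> border_vec (M $ v) (b $ v) | None \<Rightarrow> border_vec r d)"

definition state :: "('i::finite \<Rightarrow> nat \<Rightarrow> real ^ 'v) \<Rightarrow> 'i \<Rightarrow> nat \<Rightarrow> real ^ 'v option" where
  "state x i t = border_vec (x i t) (popularity x i t)"

definition z_star :: "real ^ 'v ^ 'v \<Rightarrow> real ^ 'v ^ 'v \<Rightarrow> real ^ 'v ^ 'v \<Rightarrow> real \<Rightarrow> real ^ 'v" where
  "z_star A B P q_tot =
    matrix_inv (mat 1 - A ** P) *v ((B + q_tot *\<^sub>R (mat 1 - A - B)) *v 1)"

text \<open>In the next two definitions \<open>z\<close> stands for the limit of the total attention.\<close>

definition U_tilde ::
    "real ^ 'v ^ 'v \<Rightarrow> real ^ 'v ^ 'v \<Rightarrow> real ^ 'v ^ 'v \<Rightarrow> real ^ 'v \<Rightarrow> real ^ 'v option ^ 'v option"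
  where
  "U_tilde A B P z =
    border_mat (A ** P) (B *v 1)
      ((1 / (1 \<bullet> z)) *\<^sub>R (1 v* (A ** P))) ((1 \<bullet> (B *v 1)) / (1 \<bullet> z))"

definition c_tilde :: "real ^ 'v ^ 'v \<Rightarrow> real ^ 'v ^ 'v \<Rightarrow> real ^ 'v \<Rightarrow> real ^ 'v option" where
  "c_tilde A B z =
    border_vec ((mat 1 - A - B) *v 1) ((1 \<bullet> ((mat 1 - A - B) *v 1)) / (1 \<bullet> z))"

end

theory Submission
  imports Defs
begin

text \<open>Let \<open>U\<close> and \<open>c\<close> be \<open>U_tilde\<close> and \<open>c_tilde\<close> at \<open>z\<^sup>\<star>\<close>. Both \<open>A P\<close> and \<open>U\<close> are nonnegative matrices \<open>M\<close> with a positive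
  vector \<open>y\<close> such that \<open>M y \<le> y\<close>, where every index leads along positive entries of \<open>M\<close> to one with
  strict inequality: take \<open>y = 1\<close> for \<open>A P\<close>, and \<open>y = (z\<^sup>\<star>, 1)\<close> for \<open>U\<close>, for which
  \<open>U y = y - q\<^sub>t\<^sub>o\<^sub>t c\<close>. Then \<open>M\<^sup>K y < y\<close> for some \<open>K\<close>, so \<open>Y = \<Sum>k<K. M\<^sup>k y\<close> satisfies \<open>M Y < Y\<close> and
  \<open>M\<close> contracts the sup norm with weight \<open>Y\<close>. Hence \<open>u (t + 1) = M u t + b + d t\<close> with
  \<open>d t \<longlonglongrightarrow> 0\<close> forces \<open>u t \<longlonglongrightarrow> (I - M)\<^sup>-\<^sup>1 b\<close>. The total attention satisfies such a recurrence with
  \<open>d = 0\<close> because popularities sum to \<open>1\<close>, and the states satisfy one with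
  \<open>d t = (0, \<pi> (t + 1) - (\<Sum>v. x\<^sub>v (t + 1)) / (\<Sum>v. z\<^sup>\<star>\<^sub>v))\<close>.\<close>

section \<open>Scalar contractions with a vanishing perturbation\<close>

lemma contracting_seq_tendsto_0:
  fixes a d :: "nat \<Rightarrow> real"
  assumes nonneg: "\<And>t. 0 \<le> a t" and step: "\<And>t. a (Suc t) \<le> \<rho> * a t + d t"
    and \<rho>: "0 \<le> \<rho>" "\<rho> < 1" and d: "d \<longlonglongrightarrow> 0"
  shows "a \<longlonglongrightarrow> 0"
proof (rule LIMSEQ_I)
  fix \<epsilon> :: real assume \<epsilon>: "0 < \<epsilon>"
  \<comment> \<open>With perturbations below \<open>\<epsilon> / 2 * (1 - \<rho>)\<close>, the map
    \<open>a \<mapsto> \<rho> * a + d\<close> keeps values below \<open>\<epsilon> / 2\<close>; the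
    excess of \<open>a T\<close> over that decays geometrically.\<close>
  with \<rho> have "0 < \<epsilon> / 2 * (1 - \<rho>)" by simp
  from order_tendstoD(2)[OF d this] obtain T where T: "\<And>t. t \<ge> T \<Longrightarrow> d t < \<epsilon> / 2 * (1 - \<rho>)"
    by (auto simp: eventually_sequentially)
  have bound: "a (T + k) \<le> \<rho> ^ k * a T + \<epsilon> / 2" for k
  proof (induction k)
    case 0 then show ?case using \<epsilon> by simp
  next
    case (Suc k)
    have "a (T + Suc k) \<le> \<rho> * a (T + k) + d (T + k)" using step by simp
    also have "\<dots> \<le> \<rho> * (\<rho> ^ k * a T + \<epsilon> / 2) + \<epsilon> / 2 * (1 - \<rho>)"
      using T[of "T + k"] mult_left_mono[OF Suc.IH \<rho>(1)] by simp
    also have "\<dots> = \<rho> ^ Suc k * a T + \<epsilon> / 2" by (simp add: field_simps)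
    finally show ?case .
  qed
  have "(\<lambda>k. \<rho> ^ k * a T) \<longlonglongrightarrow> 0"
    using \<rho> by (intro tendsto_mult_left_zero LIMSEQ_realpow_zero)
  from order_tendstoD(2)[OF this half_gt_zero[OF \<epsilon>]]
  obtain L where L: "\<And>k. k \<ge> L \<Longrightarrow> \<rho> ^ k * a T < \<epsilon> / 2"
    by (auto simp: eventually_sequentially)
  have "norm (a t - 0) < \<epsilon>" if t: "t \<ge> T + L" for t
  proof -
    from t have "L \<le> t - T" by simp
    with L have "\<rho> ^ (t - T) * a T < \<epsilon> / 2" by blast
    with bound[of "t - T"] nonneg[of t] t show ?thesis by simp
  qed
  then show "\<exists>n0. \<forall>t\<ge>n0. norm (a t - 0) < \<epsilon>" by blast
qed

section \<open>Nonnegative matrices contracting a weighted sup norm\<close>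

lemma nonneg_matrix_vector_mono:
  fixes M :: "real ^ 'n ^ 'n"
  assumes "\<And>v w. 0 \<le> M $ v $ w" "\<And>v. a $ v \<le> b $ v"
  shows "(M *v a) $ v \<le> (M *v b) $ v"
  using assms by (simp add: matrix_vector_mult_def sum_mono mult_left_mono)

lemma nonneg_matrix_vector_strict_mono:
  fixes M :: "real ^ 'n ^ 'n"
  assumes "\<And>v w. 0 \<le> M $ v $ w" "\<And>v. a $ v \<le> b $ v" "M $ v $ w > 0" "a $ w < b $ w"
  shows "(M *v a) $ v < (M *v b) $ v"
  unfolding matrix_vector_mult_def
  using assms by (auto intro!: sum_strict_mono_ex1 mult_left_mono bexI[of _ w])

text \<open>Such a \<open>Y\<close> is a Collatz-Wielandt certificate that the spectral radius of
  the nonnegative matrix \<open>M\<close> is below 1.\<close>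

definition contracts_weight :: "real ^ 'n ^ 'n \<Rightarrow> real ^ 'n \<Rightarrow> bool" where
  "contracts_weight M Y \<longleftrightarrow>
    (\<forall>v w. 0 \<le> M $ v $ w) \<and> (\<forall>v. 0 < Y $ v) \<and> (\<forall>v. (M *v Y) $ v < Y $ v)"

text \<open>Each application of \<open>M\<close> carries a strict inequality back along one edge.
  The iterates of \<open>y\<close> decrease, so a strict inequality once gained is kept, and a
  common exponent \<open>K\<close> serves all indices.\<close>

lemma contracts_weight_exists:
  fixes M :: "real ^ 'n ^ 'n"
  assumes M: "\<And>v w. 0 \<le> M $ v $ w" and y: "\<And>v. 0 < y $ v" and le: "\<And>v. (M *v y) $ v \<le> y $ v"
    and reach: "\<And>v. \<exists>w. (v, w) \<in> (graph_of M)\<^sup>* \<and> (M *v y) $ w < y $ w"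
  shows "\<exists>Y. contracts_weight M Y"
proof -
  define p where "p k = (((*v) M) ^^ k) y" for k
  have p0: "p 0 = y" and pSuc: "p (Suc k) = M *v p k" for k by (simp_all add: p_def)
  have p_dec: "p (Suc k) $ v \<le> p k $ v" for k v
  proof (induction k arbitrary: v)
    case 0 then show ?case by (simp add: p0 pSuc le)
  next
    case (Suc k) then show ?case unfolding pSuc[of "Suc k"]
      by (subst (2) pSuc) (intro nonneg_matrix_vector_mono M)
  qed
  have p_antimono: "p l $ v \<le> p k $ v" if "k \<le> l" for k l v
    using that by (induction rule: dec_induct) (auto intro: order_trans p_dec)
  have p_nonneg: "0 \<le> p k $ v" for k v
  proof (induction k arbitrary: v)
    case 0 then show ?case using y by (simp add: p0 less_imp_le)
  next
    case (Suc k) then show ?case by (simp add: pSuc matrix_vector_mult_def sum_nonneg M)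
  qed
  have "\<exists>k. p k $ v < y $ v" if "(v, w) \<in> (graph_of M)\<^sup>*" "(M *v y) $ w < y $ w" for v w
    using that
  proof (induction rule: converse_rtrancl_induct)
    case base
    then show ?case using pSuc[of 0] p0 by (intro exI[of _ 1]) simp
  next
    case (step v u)
    then obtain k where k: "p k $ u < y $ u" by blast
    have "p (Suc k) $ v < (M *v y) $ v"
      unfolding pSuc using step.hyps(1) k p_antimono[of 0 k] M
      by (intro nonneg_matrix_vector_strict_mono[where w = u]) (auto simp: graph_of_def p0)
    with le[of v] show ?case by (intro exI[of _ "Suc k"]) simp
  qed
  with reach have "\<forall>v. \<exists>k. p k $ v < y $ v" by blast
  then obtain k where k: "\<And>v. p (k v) $ v < y $ v" by metis
  define K where "K = Max (range k)"
  have K: "p K $ v < y $ v" for v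
    using k[of v] p_antimono[of "k v" K v] by (simp add: K_def)
  \<comment> \<open>The sum defining \<open>Y\<close> must contain \<open>p 0 = y\<close>, which is
    positive; later iterates are only known to be nonnegative. Here \<open>undefined\<close> is just
    some index.\<close>
  have "K \<noteq> 0" using K[of undefined] p0 by (metis less_irrefl)
  define Y where "Y = (\<Sum>k<K. p k)"
  have "M *v Y = (\<Sum>k<K. p (Suc k))"
    by (simp add: Y_def pSuc linear_sum[OF matrix_vector_mul_linear])
  also have "\<dots> = Y + (p K - y)"
    using sum_lessThan_telescope[of p K] by (simp add: Y_def sum_subtractf p0 algebra_simps)
  finally have "(M *v Y) $ v < Y $ v" for v using K[of v] by simp
  moreover have "0 < Y $ v" for v
  proof -
    have "p 0 $ v \<le> (\<Sum>k<K. p k $ v)"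
      using \<open>K \<noteq> 0\<close> p_nonneg by (intro member_le_sum) auto
    with y[of v] show ?thesis by (simp add: Y_def p0)
  qed
  ultimately show ?thesis using M unfolding contracts_weight_def by blast
qed

text \<open>Nonnegativity of \<open>M\<close> lets the bound
  \<open>\<bar>e t\<bar> \<le> N (e t) * Y\<close> pass through \<open>M\<close>, and
  \<open>M *v Y \<le> \<rho> * Y\<close> then gives a scalar recurrence for the weighted norm
  \<open>N (e t)\<close>.\<close>

lemma contracts_weight_tendsto_0:
  fixes M :: "real ^ 'n ^ 'n"
  assumes "contracts_weight M Y" and step: "\<And>t. e (Suc t) = M *v e t + d t" and d: "d \<longlonglongrightarrow> 0"
  shows "e \<longlonglongrightarrow> 0"
proof -
  from assms(1) have M: "\<And>v w. 0 \<le> M $ v $ w" and Y: "\<And>v. 0 < Y $ v"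
    and MY: "\<And>v. (M *v Y) $ v < Y $ v" by (auto simp: contracts_weight_def)
  define N where "N a = Max (range (\<lambda>v. \<bar>a $ v\<bar> / Y $ v))" for a :: "real ^ 'n"
  define \<rho> where "\<rho> = Max (range (\<lambda>v. (M *v Y) $ v / Y $ v))"
  have N_ge: "\<bar>a $ v\<bar> \<le> N a * Y $ v" for a v
  proof -
    have "\<bar>a $ v\<bar> / Y $ v \<le> N a" unfolding N_def by (intro Max_ge) auto
    then show ?thesis using Y[of v] by (simp add: field_simps)
  qed
  have N_le: "N a \<le> c" if "\<And>v. \<bar>a $ v\<bar> \<le> c * Y $ v" for a c
    unfolding N_def using that Y by (auto simp: field_simps)
  have N_nonneg: "0 \<le> N a" for a
    using order_trans[OF abs_ge_zero N_ge] Y by (metis less_le_not_le zero_le_mult_iff)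
  have \<rho>_ge: "(M *v Y) $ v \<le> \<rho> * Y $ v" for v
  proof -
    have "(M *v Y) $ v / Y $ v \<le> \<rho>" unfolding \<rho>_def by (intro Max_ge) auto
    then show ?thesis using Y[of v] by (simp add: field_simps)
  qed
  have \<rho>_nonneg: "0 \<le> \<rho>"
  proof -
    have "0 \<le> (M *v Y) $ undefined / Y $ undefined"
      using M Y by (simp add: matrix_vector_mult_def sum_nonneg less_imp_le)
    also have "\<dots> \<le> \<rho>" unfolding \<rho>_def by (intro Max_ge) auto
    finally show ?thesis .
  qed
  have \<rho>_less: "\<rho> < 1" unfolding \<rho>_def using MY Y by (auto simp: field_simps)
  have "N (e (Suc t)) \<le> \<rho> * N (e t) + N (d t)" for t
  proof (rule N_le)
    fix v
    have "\<bar>(M *v e t) $ v\<bar> \<le> (\<Sum>w\<in>UNIV. M $ v $ w * \<bar>e t $ w\<bar>)"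
      unfolding matrix_vector_mult_def using M
      by (auto intro!: order_trans[OF sum_abs] sum_mono simp: abs_mult)
    also have "\<dots> \<le> (\<Sum>w\<in>UNIV. M $ v $ w * (N (e t) * Y $ w))"
      by (intro sum_mono mult_left_mono M N_ge)
    also have "\<dots> = N (e t) * (M *v Y) $ v"
      by (simp add: matrix_vector_mult_def sum_distrib_left algebra_simps)
    also have "\<dots> \<le> N (e t) * (\<rho> * Y $ v)" by (intro mult_left_mono \<rho>_ge N_nonneg)
    finally show "\<bar>e (Suc t) $ v\<bar> \<le> (\<rho> * N (e t) + N (d t)) * Y $ v"
      using N_ge[of "d t" v] by (simp add: step algebra_simps)
  qed
  moreover have "(\<lambda>t. N (d t)) \<longlonglongrightarrow> 0"
  proof (rule tendsto_sandwich[OF _ _ tendsto_const])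
    show "\<forall>\<^sub>F t in sequentially. 0 \<le> N (d t)" using N_nonneg by simp
    \<comment> \<open>The maximum is bounded by a sum, whose limit can be taken term by
      term.\<close>
    have "N a \<le> (\<Sum>v\<in>UNIV. \<bar>a $ v\<bar> / Y $ v)" for a
    proof -
      have "\<bar>a $ w\<bar> / Y $ w \<le> (\<Sum>v\<in>UNIV. \<bar>a $ v\<bar> / Y $ v)" for w
        by (rule member_le_sum) (auto simp: Y less_imp_le)
      then show ?thesis unfolding N_def by auto
    qed
    then show "\<forall>\<^sub>F t in sequentially. N (d t) \<le> (\<Sum>v\<in>UNIV. \<bar>d t $ v\<bar> / Y $ v)" by simp
    have "(\<lambda>t. \<Sum>v\<in>UNIV. \<bar>d t $ v\<bar> / Y $ v) \<longlonglongrightarrow> (\<Sum>v\<in>UNIV. \<bar>(0 :: real ^ 'n) $ v\<bar> / Y $ v)"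
      using Y by (intro tendsto_intros d) (simp add: less_imp_neq[symmetric])
    then show "(\<lambda>t. \<Sum>v\<in>UNIV. \<bar>d t $ v\<bar> / Y $ v) \<longlonglongrightarrow> 0" by simp
  qed
  ultimately have N_lim: "(\<lambda>t. N (e t)) \<longlonglongrightarrow> 0"
    using contracting_seq_tendsto_0[of "\<lambda>t. N (e t)" \<rho> "\<lambda>t. N (d t)"] N_nonneg \<rho>_nonneg \<rho>_less by blast
  have "(\<lambda>t. e t $ v) \<longlonglongrightarrow> 0" for v
    by (rule Lim_null_comparison[OF _ tendsto_mult_left_zero[OF N_lim, of "Y $ v"]])
      (use N_ge in simp)
  then show ?thesis by (intro vec_tendstoI) simp
qed

text \<open>A vector fixed by \<open>M\<close> is a constant solution of the unperturbed recurrence,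
  so it equals its limit 0; a square matrix with trivial kernel is invertible.\<close>

lemma contracts_weight_invertible:
  fixes M :: "real ^ 'n ^ 'n"
  assumes "contracts_weight M Y"
  shows "invertible (mat 1 - M)"
proof -
  have "a = 0" if "(mat 1 - M) *v a = 0" for a
  proof -
    from that have "M *v a = a" by (simp add: matrix_vector_mult_diff_rdistrib)
    then have "(\<lambda>_::nat. a) \<longlonglongrightarrow> 0"
      using contracts_weight_tendsto_0[OF assms, of "\<lambda>_. a" "\<lambda>_. 0"] by simp
    then show ?thesis by (simp add: LIMSEQ_const_iff)
  qed
  then show ?thesis
    by (metis invertible_left_inverse matrix_left_invertible_ker)
qed

lemma matrix_inv_mult_vec:
  fixes M :: "real ^ 'n ^ 'n"
  assumes "invertible M"
  shows "M *v (matrix_inv M *v b) = b"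
  using someI_ex[OF assms[unfolded invertible_def]]
  by (simp add: matrix_vector_mul_assoc matrix_inv_def)

text \<open>Subtracting the fixed point \<open>l = M *v l + b\<close> turns the affine recurrence
  into the linear one for the error.\<close>

lemma contracts_weight_affine_tendsto:
  fixes M :: "real ^ 'n ^ 'n"
  assumes "contracts_weight M Y" and step: "\<And>t. u (Suc t) = M *v u t + b + d t"
    and d: "d \<longlonglongrightarrow> 0"
  shows "u \<longlonglongrightarrow> matrix_inv (mat 1 - M) *v b"
proof -
  define l where "l = matrix_inv (mat 1 - M) *v b"
  have "l - M *v l = b"
    using matrix_inv_mult_vec[OF contracts_weight_invertible[OF assms(1)], of b]
    by (simp add: l_def matrix_vector_mult_diff_rdistrib)
  then have "u (Suc t) - l = M *v (u t - l) + d t" for t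
    by (simp add: step matrix_vector_mult_diff_distrib algebra_simps)
  from contracts_weight_tendsto_0[OF assms(1), of "\<lambda>t. u t - l", OF this d]
  show ?thesis unfolding l_def[symmetric] by (simp add: LIM_zero_iff)
qed

section \<open>Bordered and diagonal matrices\<close>

lemma sum_UNIV_option:
  fixes f :: "'a::finite option \<Rightarrow> 'b::comm_monoid_add"
  shows "(\<Sum>k\<in>UNIV. f k) = f None + (\<Sum>v\<in>UNIV. f (Some v))"
  by (simp add: UNIV_option_conv sum.reindex)

lemma border_mat_mult_border_vec:
  "border_mat M b r d *v border_vec a c = border_vec (M *v a + c *\<^sub>R b) (r \<bullet> a + d * c)"
  by (simp add: vec_eq_iff matrix_vector_mult_def border_mat_def border_vec_def sum_UNIV_option
      inner_vec_def algebra_simps split: option.splits)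

text \<open>The last row is the sum of the user rows divided by \<open>1 \<bullet> z\<close>, so the
  last coordinate of the product is a popularity computed with \<open>1 \<bullet> z\<close> as
  total.\<close>

lemma U_tilde_mult_border_vec:
  fixes A B P :: "real ^ 'v ^ 'v"
  shows "U_tilde A B P z *v border_vec a c =
    border_vec ((A ** P) *v a + c *\<^sub>R (B *v 1)) ((1 \<bullet> ((A ** P) *v a + c *\<^sub>R (B *v 1))) / (1 \<bullet> z))"
  by (simp add: U_tilde_def border_mat_mult_border_vec inner_add_right add_divide_distrib
      dot_lmul_matrix mult.commute)

lemma diag_mat_mult_vec: "(diag_mat a *v y) $ v = a $ v * y $ v"
  by (simp add: diag_mat_def matrix_vector_mult_def if_distrib[of "\<lambda>c. c * _"] cong: if_cong)

lemma diag_mat_mult: "(diag_mat a ** P) $ v $ w = a $ v * P $ v $ w"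
  by (simp add: diag_mat_def matrix_matrix_mult_def if_distrib[of "\<lambda>c. c * _"] cong: if_cong)

text \<open>Invertibility and \<open>1 \<bullet> z_lim \<noteq> 0\<close> are part of the conclusion
  because \<open>matrix_inv\<close> and division are total, so the limit formula alone would not say
  that its inverses and quotients are genuine.\<close>

theorem theorem3:
  fixes P A B :: "real ^ 'v ^ 'v"
    and \<alpha> \<beta> \<gamma> :: "real ^ 'v"
    and q :: "'i::finite \<Rightarrow> real"
    and x :: "'i \<Rightarrow> nat \<Rightarrow> real ^ 'v"
    and q_tot :: real
    and z_lim :: "real ^ 'v"
  assumes P: "row_stochastic P"
    and coeffs_nonneg: "\<And>v. 0 \<le> \<alpha> $ v" "\<And>v. 0 \<le> \<beta> $ v" "\<And>v. 0 \<le> \<gamma> $ v"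
    and coeffs_sum: "\<And>v. \<alpha> $ v + \<beta> $ v + \<gamma> $ v = 1"
    and A: "A = diag_mat \<alpha>"
    and B: "B = diag_mat \<beta>"
    and quality: "\<And>i. q i \<in> {0..1}"
    and attention: "\<And>i t v. x i t $ v \<in> {0..1}"
    and dynamics: "\<And>i t. x i (Suc t) =
          (A ** P) *v x i t + popularity x i t *\<^sub>R (B *v 1) + q i *\<^sub>R ((mat 1 - A - B) *v 1)"
    and paths: "\<And>v. \<exists>w. (v, w) \<in> (graph_of P)\<^sup>* \<and> aperiodic_node (graph_of P) w \<and> \<gamma> $ w > 0"
    and q_tot: "q_tot = (\<Sum>i\<in>UNIV. q i)"
    and q_tot_ge: "q_tot \<ge> 1"
    and initial: "total_attention x 0 \<ge> 1"
    and z_lim: "z_lim = z_star A B P q_tot"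
  shows "invertible (mat 1 - A ** P)
    \<and> total_attention x \<longlonglongrightarrow> z_lim
    \<and> 1 \<bullet> z_lim \<noteq> 0
    \<and> invertible (mat 1 - U_tilde A B P z_lim)
    \<and> (\<forall>i. state x i \<longlonglongrightarrow>
          q i *\<^sub>R (matrix_inv (mat 1 - U_tilde A B P z_lim) *v c_tilde A B z_lim))"
proof -
  define M where "M = A ** P"
  define g where "g = (mat 1 - A - B) *v 1"
  define N where "N z = 1 \<bullet> z" for z :: "real ^ 'v"
  have P_nonneg: "0 \<le> P $ v $ w" and P_sum: "(\<Sum>w\<in>UNIV. P $ v $ w) = 1" for v w
    using P by (auto simp: row_stochastic_def)
  have M_eq: "M $ v $ w = \<alpha> $ v * P $ v $ w" for v w by (simp add: M_def A diag_mat_mult)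
  have M_nonneg: "0 \<le> M $ v $ w" for v w by (simp add: M_eq coeffs_nonneg P_nonneg)
  have M_one: "(M *v 1) $ v = \<alpha> $ v" for v
    by (simp add: matrix_vector_mult_def M_eq P_sum flip: sum_distrib_left)
  have B_one: "(B *v 1) $ v = \<beta> $ v" for v by (simp add: B diag_mat_mult_vec)
  have g_eq: "g $ v = \<gamma> $ v" for v
    using coeffs_sum[of v]
    by (simp add: g_def A B matrix_vector_mult_diff_rdistrib diag_mat_mult_vec)
  have N_sum: "N z = (\<Sum>v\<in>UNIV. z $ v)" for z by (simp add: N_def inner_vec_def)
  have N_add: "N (a + b) = N a + N b" and N_scale: "N (c *\<^sub>R a) = c * N a" for a b c
    by (simp_all add: N_def inner_add_right)

  \<comment> \<open>Contraction by \<open>A P\<close>\<close>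
  have "\<exists>w. (v, w) \<in> (graph_of M)\<^sup>* \<and> (M *v 1) $ w < (1 :: real ^ 'v) $ w" for v
  proof -
    from paths obtain w where "(v, w) \<in> (graph_of P)\<^sup>*" "\<gamma> $ w > 0" by blast
    then show ?thesis
    proof (induction rule: converse_rtrancl_induct)
      case base
      then show ?case using coeffs_sum[of w] coeffs_nonneg(2)[of w]
        by (intro exI[of _ w]) (simp add: M_one)
    next
      case (step v u)
      show ?case
      \<comment> \<open>If \<open>\<alpha> $ v < 1\<close>, the inequality is strict at
        \<open>v\<close> itself; otherwise the edge of \<open>P\<close> survives in
        \<open>M\<close>.\<close>
      proof (cases "\<alpha> $ v < 1")
        case True then show ?thesis by (intro exI[of _ v]) (simp add: M_one)
      next
        case False
        with step.hyps have "(v, u) \<in> graph_of M" by (simp add: graph_of_def M_eq)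
        with step show ?thesis by (meson converse_rtrancl_into_rtrancl)
      qed
    qed
  qed
  moreover have "(M *v 1) $ v \<le> (1 :: real ^ 'v) $ v" for v
    using coeffs_sum[of v] coeffs_nonneg[of v] by (simp add: M_one)
  ultimately obtain Y where Y: "contracts_weight M Y"
    using contracts_weight_exists[of M 1] M_nonneg by auto

  \<comment> \<open>Convergence of the total attention\<close>
  define z where "z = total_attention x"
  have pop: "popularity x i t = N (x i t) / N (z t)" for i t
    unfolding popularity_def z_def total_attention_def N_sum
    by (subst sum.swap) simp
  have sum_pop: "(\<Sum>i\<in>UNIV. popularity x i t) = 1" if "N (z t) \<noteq> 0" for t
  proof -
    have "(\<Sum>i\<in>UNIV. N (x i t)) = N (z t)"
      by (simp add: z_def total_attention_def N_def inner_sum_right)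
    with that show ?thesis by (simp add: pop flip: sum_divide_distrib)
  qed
  have N_pos: "N a > 0" if "\<And>v. 1 \<le> a $ v" for a
    unfolding N_sum using that by (intro sum_pos) (auto intro: less_le_trans[OF zero_less_one])
  have z_Suc': "z (Suc t) = M *v z t + B *v 1 + q_tot *\<^sub>R g" if "N (z t) \<noteq> 0" for t
    using sum_pop[OF that]
    by (simp add: z_def total_attention_def dynamics sum.distrib M_def g_def q_tot
        linear_sum[OF matrix_vector_mul_linear] flip: scaleR_left.sum)
  \<comment> \<open>The bound is preserved because
    \<open>\<alpha> + \<beta> + q_tot * \<gamma> \<ge> 1\<close> at every user. It keeps the total
    positive, which is what makes the popularities sum to 1 in the next step.\<close>
  have z_ge: "1 \<le> z t $ v" for t v
  proof (induction t arbitrary: v)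
    case 0 then show ?case using initial by (simp add: z_def less_eq_vec_def)
  next
    case (Suc t)
    have "(M *v 1) $ v \<le> (M *v z t) $ v"
      by (intro nonneg_matrix_vector_mono M_nonneg) (simp add: Suc)
    moreover have "\<gamma> $ v \<le> q_tot * \<gamma> $ v"
      using q_tot_ge coeffs_nonneg(3)[of v] by (simp add: mult_le_cancel_right1)
    moreover have "N (z t) \<noteq> 0" using N_pos[OF Suc] by simp
    ultimately show ?case
      using coeffs_sum[of v] by (simp add: z_Suc' M_one B_one g_eq)
  qed
  have Nz_pos: "N (z t) > 0" for t using N_pos z_ge by blast
  have z_Suc: "z (Suc t) = M *v z t + (B *v 1 + q_tot *\<^sub>R g) + 0" for t
    using z_Suc'[of t] Nz_pos[of t] by simp
  have z_lim_eq: "z_lim = matrix_inv (mat 1 - M) *v (B *v 1 + q_tot *\<^sub>R g)"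
    by (simp add: z_lim z_star_def M_def g_def matrix_vector_mult_add_rdistrib
        scaleR_matrix_vector_assoc)
  have z_tendsto: "z \<longlonglongrightarrow> z_lim"
    unfolding z_lim_eq
    by (rule contracts_weight_affine_tendsto[OF Y, where d = "\<lambda>_. 0"]) (use z_Suc in auto)
  have z_lim_ge: "1 \<le> z_lim $ v" for v
    by (rule LIMSEQ_le_const[OF tendsto_vec_nth[OF z_tendsto]]) (use z_ge in blast)
  have N_lim_pos: "N z_lim > 0" using N_pos z_lim_ge by blast
  have z_lim_fixed: "M *v z_lim + B *v 1 = z_lim - q_tot *\<^sub>R g"
    using matrix_inv_mult_vec[OF contracts_weight_invertible[OF Y], of "B *v 1 + q_tot *\<^sub>R g"]
    unfolding z_lim_eq[symmetric] by (simp add: matrix_vector_mult_diff_rdistrib algebra_simps)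

  \<comment> \<open>Contraction by the bordered matrix\<close>
  define U where "U = U_tilde A B P z_lim"
  define c where "c = c_tilde A B z_lim"
  \<comment> \<open>This is the expected limit of the states summed over all influencers, hence a
    solution of \<open>y = U *v y + q_tot *\<^sub>R c\<close>.\<close>
  define y where "y = border_vec z_lim 1"
  have y_Some: "y $ Some v = z_lim $ v" and y_None: "y $ None = 1" for v
    by (simp_all add: y_def border_vec_def)
  have U_mult: "U *v border_vec a p = border_vec (M *v a + p *\<^sub>R (B *v 1))
      (N (M *v a + p *\<^sub>R (B *v 1)) / N z_lim)" for a p
    by (simp add: U_def U_tilde_mult_border_vec M_def N_def)
  have U_Some_Some: "U $ Some v $ Some w = M $ v $ w" and U_Some_None: "U $ Some v $ None = \<beta> $ v"
    for v w
    by (simp_all add: U_def U_tilde_def border_mat_def border_vec_def M_def B_one)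
  have U_nonneg: "0 \<le> U $ k $ l" for k l
  proof -
    have "0 \<le> (1 v* M) $ w" for w
      by (simp add: vector_matrix_mult_def sum_nonneg M_nonneg)
    moreover have "0 \<le> 1 \<bullet> (B *v 1)" by (simp add: inner_vec_def B_one sum_nonneg coeffs_nonneg)
    ultimately show ?thesis using N_lim_pos M_nonneg coeffs_nonneg
      by (simp add: U_def U_tilde_def border_mat_def border_vec_def B_one flip: M_def N_def
          split: option.splits)
  qed
  have Uy: "U *v y = border_vec (z_lim - q_tot *\<^sub>R g) (1 - q_tot * N g / N z_lim)"
    using N_lim_pos
    by (simp add: y_def U_mult z_lim_fixed N_def inner_diff_right diff_divide_distrib)
  have Ng_pos: "0 < N g"
  proof -
    from paths obtain w where "\<gamma> $ w > 0" by blast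
    then show ?thesis unfolding N_sum g_eq using coeffs_nonneg(3) by (intro sum_pos2[of _ w]) auto
  qed
  have U_None: "(U *v y) $ None < y $ None"
    using Ng_pos N_lim_pos q_tot_ge by (simp add: Uy y_None) (simp add: border_vec_def)
  have U_Some: "(U *v y) $ Some v = y $ Some v - q_tot * \<gamma> $ v" for v
    by (simp add: Uy y_Some) (simp add: border_vec_def g_eq)
  have "(U *v y) $ k \<le> y $ k" for k
    using U_None U_Some q_tot_ge coeffs_nonneg(3) by (cases k) auto
  moreover have "0 < y $ k" for k
    using less_le_trans[OF zero_less_one z_lim_ge] by (cases k) (simp_all add: y_Some y_None)
  moreover have "\<exists>l. (k, l) \<in> (graph_of U)\<^sup>* \<and> (U *v y) $ l < y $ l" for k
  proof (cases k)
    case None then show ?thesis using U_None by blast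
  next
    case (Some v)
    from paths obtain w where "(v, w) \<in> (graph_of P)\<^sup>*" "\<gamma> $ w > 0" by blast
    then show ?thesis unfolding Some
    proof (induction rule: converse_rtrancl_induct)
      case base
      then show ?case using U_Some q_tot_ge by (intro exI[of _ "Some w"]) simp
    next
      case (step v u)
      \<comment> \<open>The inequality is strict at \<open>Some v\<close>, or an edge leads to
        \<open>None\<close>, where it is strict, or \<open>\<alpha> $ v = 1\<close> and the edge of
        \<open>P\<close> survives in \<open>U\<close>.\<close>
      consider "\<gamma> $ v > 0" | "\<beta> $ v > 0" | "\<alpha> $ v = 1"
        using coeffs_sum[of v] coeffs_nonneg[of v] by linarith
      then show ?case
      proof cases
        case 1
        then show ?thesis using U_Some q_tot_ge by (intro exI[of _ "Some v"]) simp
      next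
        case 2
        then have "(Some v, None) \<in> graph_of U" by (simp add: graph_of_def U_Some_None)
        then show ?thesis using U_None by blast
      next
        case 3
        with step.hyps have "(Some v, Some u) \<in> graph_of U"
          by (simp add: graph_of_def U_Some_Some M_eq)
        with step show ?thesis by (meson converse_rtrancl_into_rtrancl)
      qed
    qed
  qed
  ultimately obtain Y' where Y': "contracts_weight U Y'"
    using contracts_weight_exists[of U y] U_nonneg by blast

  \<comment> \<open>Convergence of the states\<close>
  have "state x i \<longlonglongrightarrow> q i *\<^sub>R (matrix_inv (mat 1 - U) *v c)" for i
  proof -
    \<comment> \<open>The true popularity divides by the current total, \<open>U\<close> and
      \<open>c\<close> by the limiting one; the discrepancy sits in the last coordinate
      only.\<close>
    define d where
      "d t = border_vec (0 :: real ^ 'v) (popularity x i (Suc t) - N (x i (Suc t)) / N z_lim)" for t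
    have step: "state x i (Suc t) = U *v state x i t + q i *\<^sub>R c + d t" for t
    proof -
      define h where "h = M *v x i t + popularity x i t *\<^sub>R (B *v 1)"
      have x_Suc: "x i (Suc t) = h + q i *\<^sub>R g" by (simp add: dynamics h_def M_def g_def)
      then have "N (x i (Suc t)) = N h + q i * N g" by (simp add: N_add N_scale)
      with x_Suc show ?thesis
        unfolding state_def U_mult c_def c_tilde_def d_def
        by (simp add: border_vec_def vec_eq_iff add_divide_distrib
            flip: g_def N_def h_def split: option.splits)
    qed
    have pop_bounds: "0 \<le> popularity x i t" "popularity x i t \<le> 1" for t
    proof -
      have nonneg: "0 \<le> popularity x j t" for j
        unfolding popularity_def using attention by (intro divide_nonneg_nonneg sum_nonneg) auto
      then show "0 \<le> popularity x i t" .
      have "popularity x i t \<le> (\<Sum>j\<in>UNIV. popularity x j t)"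
        using nonneg by (intro member_le_sum) auto
      then show "popularity x i t \<le> 1" using sum_pop[of t] Nz_pos[of t] by simp
    qed
    have "(\<lambda>t. 1 - N (z (Suc t)) / N z_lim) \<longlonglongrightarrow> 1 - N z_lim / N z_lim"
      unfolding N_def using N_lim_pos
      by (intro tendsto_intros LIMSEQ_Suc z_tendsto) (simp add: N_def)
    then have ratio: "(\<lambda>t. 1 - N (z (Suc t)) / N z_lim) \<longlonglongrightarrow> 0" using N_lim_pos by simp
    \<comment> \<open>Writing \<open>N (x i (Suc t))\<close> as popularity times
      \<open>N (z (Suc t))\<close> exhibits the error as a bounded factor times a null
      sequence.\<close>
    have d_None: "d t $ None = popularity x i (Suc t) * (1 - N (z (Suc t)) / N z_lim)" for t
      using Nz_pos[of "Suc t"] N_lim_pos by (simp add: d_def border_vec_def pop field_simps)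
    have "(\<lambda>t. d t $ None) \<longlonglongrightarrow> 0"
    proof (rule Lim_null_comparison[OF _ tendsto_rabs_zero[OF ratio]])
      show "\<forall>\<^sub>F t in sequentially. norm (d t $ None) \<le> \<bar>1 - N (z (Suc t)) / N z_lim\<bar>"
        using pop_bounds by (simp add: d_None abs_mult mult_left_le_one_le)
    qed
    then have "(\<lambda>t. d t $ k) \<longlonglongrightarrow> 0" for k
      by (cases k) (auto simp: d_def border_vec_def)
    then have "d \<longlonglongrightarrow> 0" by (intro vec_tendstoI) simp
    from contracts_weight_affine_tendsto[OF Y' step this] show ?thesis
      by (simp add: matrix_vector_mult_scaleR)
  qed
  then show ?thesis
    using contracts_weight_invertible[OF Y] contracts_weight_invertible[OF Y'] z_tendsto N_lim_pos
    by (simp add: M_def z_def N_def U_def c_def)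
qed

end
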